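(* Let $Q=(q_{ij})$ be a real symmetric $n\times n$ matrix with zero diagonal, $c\in\mathbb{R}^n$, $R_i=\{j:q_{ij}\neq0\}$, and let $\beta_{ij}>0$ for $j\in R_i$, $i=1,\dots,n$. Consider the MILP PK($*,\beta$) in variables $x_i$ and $y_{ij}$ ($j\in R_i$): maximize $\sum_{i=1}^n\sum_{j\in R_i}q_{ij}y_{ij}+\sum_{i=1}^n c_ix_i$ subject to $x_i+x_j-y_{ij}\le 1$ for all $j\in R_i$, $i=1,\dots,n$; $\sum_{j\in R_i}\beta_{ij}(y_{ij}+y_{ji})\le 2\left(\sum_{j\in R_i}\beta_{ij}\right)x_i$ for $i=1,\dots,n$; $x_i\in\{0,1\}$ for all $i$; $0\le y_{ij}\le 1$ for all $j\in R_i$, $i=1,\dots,n$. Then PK($*,\beta$) is a valid formulation of QUBO.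
   Context: QUBO is the problem: maximize $\sum_{i=1}^n\sum_{j\in R_i}q_{ij}x_ix_j+\sum_{i=1}^n c_ix_i$ over $x\in\{0,1\}^n$. An MILP in variables $(x,y)$ with objective $\sum_i\sum_{j\in R_i}q_{ij}y_{ij}+\sum_i c_ix_i$ is a valid formulation of QUBO if its optimal objective value equals the optimal value of QUBO and the $x$-part of every optimal solution of the MILP is an optimal solution of QUBO. *)

theory Defs
  imports "HOL-Analysis.Analysis"
begin

definition optimal_solution :: "'s set \<Rightarrow> ('s \<Rightarrow> real) \<Rightarrow> 's \<Rightarrow> bool" where
  "optimal_solution F f s \<longleftrightarrow> s \<in> F \<and> (\<forall>t\<in>F. f t \<le> f s)"

text \<open>A relation rather than a supremum, so that an infeasible or unbounded problem,
  or one whose supremum is not attained, has no optimal value.\<close>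

definition has_optimal_value :: "'s set \<Rightarrow> ('s \<Rightarrow> real) \<Rightarrow> real \<Rightarrow> bool" where
  "has_optimal_value F f v \<longleftrightarrow> (\<exists>s. optimal_solution F f s \<and> f s = v)"

definition R :: "real^'n^'n \<Rightarrow> 'n \<Rightarrow> 'n set" where
  "R Q i = {j. Q $ i $ j \<noteq> 0}"

definition binary_vectors :: "(real^'n) set" where
  "binary_vectors = {x. \<forall>i. x $ i \<in> {0, 1}}"

definition qubo_objective :: "real^'n^'n \<Rightarrow> real^'n \<Rightarrow> real^'n \<Rightarrow> real" where
  "qubo_objective Q c x =
     (\<Sum>i\<in>UNIV. \<Sum>j\<in>R Q i. Q $ i $ j * x $ i * x $ j) + (\<Sum>i\<in>UNIV. c $ i * x $ i)"

definition milp_objective ::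
  "real^'n^'n \<Rightarrow> real^'n \<Rightarrow> (real^'n) \<times> ('n \<times> 'n \<Rightarrow> real) \<Rightarrow> real" where
  "milp_objective Q c = (\<lambda>(x, y).
     (\<Sum>i\<in>UNIV. \<Sum>j\<in>R Q i. Q $ i $ j * y (i, j)) + (\<Sum>i\<in>UNIV. c $ i * x $ i))"

text \<open>An MILP in the variables \<open>(x, y)\<close> with the above objective is given by its feasible set.\<close>

definition valid_formulation ::
  "real^'n^'n \<Rightarrow> real^'n \<Rightarrow> ((real^'n) \<times> ('n \<times> 'n \<Rightarrow> real)) set \<Rightarrow> bool" where
  "valid_formulation Q c F \<longleftrightarrow>
     (\<exists>v. has_optimal_value F (milp_objective Q c) v
        \<and> has_optimal_value binary_vectors (qubo_objective Q c) v) \<and>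
     (\<forall>x y. optimal_solution F (milp_objective Q c) (x, y) \<longrightarrow>
        optimal_solution binary_vectors (qubo_objective Q c) x)"

text \<open>There is a variable \<open>y\<^sub>i\<^sub>j\<close> only for \<open>j \<in> R Q i\<close>, hence the extensional function space
  \<open>\<rightarrow>\<^sub>E\<close>, which also carries the bounds \<open>0 \<le> y\<^sub>i\<^sub>j \<le> 1\<close>. For symmetric \<open>Q\<close> the
  variable \<open>y\<^sub>j\<^sub>i\<close> exists whenever \<open>y\<^sub>i\<^sub>j\<close> does.\<close>

definition PK_feasible ::
  "real^'n^'n \<Rightarrow> ('n \<Rightarrow> 'n \<Rightarrow> real) \<Rightarrow> ((real^'n) \<times> ('n \<times> 'n \<Rightarrow> real)) set" where
  "PK_feasible Q \<beta> = {(x, y).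
     (\<forall>i. \<forall>j\<in>R Q i. x $ i + x $ j - y (i, j) \<le> 1) \<and>
     (\<forall>i. (\<Sum>j\<in>R Q i. \<beta> i j * (y (i, j) + y (j, i))) \<le> 2 * (\<Sum>j\<in>R Q i. \<beta> i j) * x $ i) \<and>
     (\<forall>i. x $ i \<in> {0, 1}) \<and>
     y \<in> (SIGMA i:UNIV. R Q i) \<rightarrow>\<^sub>E {0..1}}"

end

theory Submission
  imports Defs
begin

text \<open>Every feasible \<open>(x, y)\<close> has \<open>y\<^sub>i\<^sub>j = x\<^sub>i x\<^sub>j\<close>: the first constraint forces \<open>y\<^sub>i\<^sub>j = 1\<close> when
  \<open>x\<^sub>i = x\<^sub>j = 1\<close>, and when \<open>x\<^sub>i = 0\<close> the weighted sum with positive weights \<open>\<beta>\<^sub>i\<^sub>j\<close> forces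
  \<open>y\<^sub>i\<^sub>j = y\<^sub>j\<^sub>i = 0\<close> for every \<open>j\<close>. Thus the MILP is QUBO itself, carried over to the graph of
  \<open>x \<mapsto> (x\<^sub>i x\<^sub>j)\<close>.\<close>

text \<open>The restriction to pairs with \<open>j \<in> R Q i\<close> matches the extensional
  function space in \<open>PK_feasible\<close>, so that a feasible \<open>y\<close> can equal this
  function outright and not only on the index pairs.\<close>

definition product_extension :: "real^'n^'n \<Rightarrow> real^'n \<Rightarrow> 'n \<times> 'n \<Rightarrow> real" where
  "product_extension Q x = (\<lambda>(i, j)\<in>(SIGMA i:UNIV. R Q i). x $ i * x $ j)"

lemma product_extension_apply:
  "j \<in> R Q i \<Longrightarrow> product_extension Q x (i, j) = x $ i * x $ j"
  by (simp add: product_extension_def)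

lemma milp_objective_product_extension:
  "milp_objective Q c (x, product_extension Q x) = qubo_objective Q c x"
  by (simp add: milp_objective_def qubo_objective_def product_extension_apply mult.assoc
      cong: sum.cong)

lemma R_sym:
  assumes "transpose Q = Q" and "j \<in> R Q i"
  shows "i \<in> R Q j"
proof -
  have "Q $ j $ i = transpose Q $ i $ j"
    by (simp add: transpose_def)
  with assms show ?thesis
    by (simp add: R_def)
qed

lemma PK_feasible_zero:
  assumes sym: "transpose Q = Q"
    and pos: "\<And>i j. j \<in> R Q i \<Longrightarrow> \<beta> i j > 0"
    and feas: "(x, y) \<in> PK_feasible Q \<beta>"
    and j: "j \<in> R Q i" and x0: "x $ i = 0"
  shows "y (i, j) = 0" and "y (j, i) = 0"
proof -
  have nonneg: "y (k, l) \<ge> 0" if "l \<in> R Q k" for k l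
    using feas that by (auto simp: PK_feasible_def PiE_iff)
  \<comment> \<open>Symmetry of \<open>Q\<close> makes \<open>y (k, i)\<close> a variable of the
    MILP too, so its lower bound 0 is available.\<close>
  have terms: "\<beta> i k * (y (i, k) + y (k, i)) \<ge> 0" if "k \<in> R Q i" for k
    using pos[OF that] nonneg[OF that] nonneg[OF R_sym[OF sym that]] by simp
  have "(\<Sum>k\<in>R Q i. \<beta> i k * (y (i, k) + y (k, i))) \<le> 2 * (\<Sum>k\<in>R Q i. \<beta> i k) * x $ i"
    using feas by (simp add: PK_feasible_def)
  then have "(\<Sum>k\<in>R Q i. \<beta> i k * (y (i, k) + y (k, i))) = 0"
    using x0 terms by (simp add: sum_nonneg order_antisym)
  then have "\<beta> i j * (y (i, j) + y (j, i)) = 0"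
    using terms j by (simp add: sum_nonneg_eq_0_iff)
  then have "y (i, j) + y (j, i) = 0"
    using pos[OF j] by simp
  then show "y (i, j) = 0" and "y (j, i) = 0"
    using nonneg[OF j] nonneg[OF R_sym[OF sym j]] by linarith+
qed

lemma PK_feasible_imp_product_extension:
  fixes Q :: "real^'n^'n"
  assumes sym: "transpose Q = Q"
    and pos: "\<And>i j. j \<in> R Q i \<Longrightarrow> \<beta> i j > 0"
    and feas: "(x, y) \<in> PK_feasible Q \<beta>"
  shows "y = product_extension Q x"
proof
  have y: "y \<in> (SIGMA i:UNIV. R Q i) \<rightarrow>\<^sub>E {0..1}" and bin: "x $ i = 0 \<or> x $ i = 1" for i
    using feas by (auto simp: PK_feasible_def)
  fix p :: "'n \<times> 'n"
  obtain i j where p: "p = (i, j)"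
    by (cases p)
  show "y p = product_extension Q x p"
  proof (cases "j \<in> R Q i")
    case j: True
    consider "x $ i = 0" | "x $ j = 0" | "x $ i = 1" "x $ j = 1"
      using bin by blast
    then have "y (i, j) = x $ i * x $ j"
    proof cases
      case 1
      then show ?thesis
        using PK_feasible_zero(1)[OF sym pos feas j] by simp
    next
      \<comment> \<open>Here the weighted constraint of index \<open>j\<close> is the one that
        bites; in it \<open>y (i, j)\<close> occurs as the reversed variable.\<close>
      case 2
      then show ?thesis
        using PK_feasible_zero(2)[OF sym pos feas R_sym[OF sym j]] by simp
    next
      case 3
      have "y (i, j) \<le> 1"
        using y j by (auto simp: PiE_iff)
      moreover have "x $ i + x $ j - y (i, j) \<le> 1"
        using feas j by (simp add: PK_feasible_def)
      ultimately show ?thesis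
        using 3 by simp
    qed
    then show ?thesis
      using j by (simp add: p product_extension_apply)
  next
    case False
    \<comment> \<open>Off the index pairs both functions take the value
      \<open>undefined\<close>.\<close>
    then show ?thesis
      using PiE_arb[OF y, of p] by (simp add: p product_extension_def)
  qed
qed

text \<open>The weighted constraint holds term by term: \<open>y (i, j) + y (j, i)\<close> is 2 x_i
  x_j, which is at most 2 x_i.\<close>

lemma product_extension_feasible:
  assumes sym: "transpose Q = Q"
    and pos: "\<And>i j. j \<in> R Q i \<Longrightarrow> \<beta> i j > 0"
    and x: "x \<in> binary_vectors"
  shows "(x, product_extension Q x) \<in> PK_feasible Q \<beta>"
proof -
  let ?y = "product_extension Q x"
  have bin: "x $ i = 0 \<or> x $ i = 1" for i
    using x by (simp add: binary_vectors_def)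
  \<comment> \<open>In order: the bound behind the weighted constraint, the linking constraint, and
    the two bounds on \<open>y\<close>.\<close>
  have le: "x $ i * x $ j \<le> x $ i" "x $ i + x $ j - x $ i * x $ j \<le> 1"
      "0 \<le> x $ i * x $ j" "x $ i * x $ j \<le> 1" for i j
    using bin[of i] bin[of j] by auto
  have "(\<Sum>j\<in>R Q i. \<beta> i j * (?y (i, j) + ?y (j, i))) \<le> 2 * (\<Sum>j\<in>R Q i. \<beta> i j) * x $ i" for i
  proof -
    have "(\<Sum>j\<in>R Q i. \<beta> i j * (?y (i, j) + ?y (j, i))) \<le> (\<Sum>j\<in>R Q i. \<beta> i j * (2 * x $ i))"
    proof (intro sum_mono mult_left_mono)
      fix j assume j: "j \<in> R Q i"
      show "?y (i, j) + ?y (j, i) \<le> 2 * x $ i"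
        using le(1)[of i j] j R_sym[OF sym j]
        by (simp add: product_extension_apply mult.commute)
      show "0 \<le> \<beta> i j"
        using pos[OF j] by simp
    qed
    also have "\<dots> = 2 * (\<Sum>j\<in>R Q i. \<beta> i j) * x $ i"
      by (simp add: sum_distrib_right[symmetric])
    finally show ?thesis .
  qed
  moreover have "?y \<in> (SIGMA i:UNIV. R Q i) \<rightarrow>\<^sub>E {0..1}"
    using le by (auto simp: product_extension_def)
  ultimately show ?thesis
    using bin le by (simp add: PK_feasible_def product_extension_apply)
qed

lemma PK_feasible_eq_image:
  assumes "transpose Q = Q"
    and "\<And>i j. j \<in> R Q i \<Longrightarrow> \<beta> i j > 0"
  shows "PK_feasible Q \<beta> = (\<lambda>x. (x, product_extension Q x)) ` binary_vectors"
proof (intro set_eqI iffI)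
  fix s assume s: "s \<in> PK_feasible Q \<beta>"
  obtain x y where xy: "s = (x, y)"
    by (cases s)
  have "x \<in> binary_vectors"
    using s by (simp add: xy PK_feasible_def binary_vectors_def)
  moreover have "y = product_extension Q x"
    using PK_feasible_imp_product_extension[OF assms] s by (simp add: xy)
  ultimately show "s \<in> (\<lambda>x. (x, product_extension Q x)) ` binary_vectors"
    by (simp add: xy)
next
  fix s assume "s \<in> (\<lambda>x. (x, product_extension Q x)) ` binary_vectors"
  then show "s \<in> PK_feasible Q \<beta>"
    using product_extension_feasible[OF assms] by auto
qed

text \<open>A binary vector is the indicator of the set of its ones. Finiteness ensures that the
  QUBO optimum is attained.\<close>

lemma finite_binary_vectors: "finite (binary_vectors :: (real^'n) set)"
proof (rule finite_subset)
  show "(binary_vectors :: (real^'n) set) \<subseteq> (\<lambda>S. \<chi> i. of_bool (i \<in> S)) ` UNIV"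
  proof
    fix x :: "real^'n" assume "x \<in> binary_vectors"
    then have "x = (\<chi> i. of_bool (i \<in> {i. x $ i = 1}))"
      by (auto simp: binary_vectors_def vec_eq_iff)
    then show "x \<in> (\<lambda>S. \<chi> i. of_bool (i \<in> S)) ` UNIV"
      by blast
  qed
qed simp

lemma finite_imp_optimal_solution:
  assumes "finite F" and "F \<noteq> {}"
  shows "\<exists>s. optimal_solution F f s"
  using Max_in[of "f ` F"] Max_ge[of "f ` F"] assms
  unfolding optimal_solution_def by fastforce

text \<open>Optimality only compares objective values, and on the image these are the
  \<open>f (g t)\<close> with \<open>t \<in> F\<close>.\<close>

lemma optimal_solution_image:
  assumes "x \<in> F"
  shows "optimal_solution (g ` F) f (g x) \<longleftrightarrow> optimal_solution F (\<lambda>x. f (g x)) x"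
  using assms by (auto simp: optimal_solution_def)

theorem theorem6:
  fixes Q :: "real^'n^'n" and c :: "real^'n" and \<beta> :: "'n \<Rightarrow> 'n \<Rightarrow> real"
  assumes "transpose Q = Q"
    and "\<And>i. Q $ i $ i = 0"
    and "\<And>i j. j \<in> R Q i \<Longrightarrow> \<beta> i j > 0"
  shows "valid_formulation Q c (PK_feasible Q \<beta>)"
proof -
  let ?g = "\<lambda>x. (x, product_extension Q x)"
  have F: "PK_feasible Q \<beta> = ?g ` binary_vectors"
    by (rule PK_feasible_eq_image[OF assms(1,3)])
  have opt: "optimal_solution (PK_feasible Q \<beta>) (milp_objective Q c) (?g x) \<longleftrightarrow>
      optimal_solution binary_vectors (qubo_objective Q c) x" if "x \<in> binary_vectors" for x
    unfolding F using that
    by (simp add: optimal_solution_image[where g = ?g] milp_objective_product_extension)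
  have "0 \<in> (binary_vectors :: (real^'n) set)"
    by (simp add: binary_vectors_def)
  then obtain x where x: "optimal_solution binary_vectors (qubo_objective Q c) x"
    using finite_imp_optimal_solution[OF finite_binary_vectors] by blast
  then have "optimal_solution (PK_feasible Q \<beta>) (milp_objective Q c) (?g x)"
    using opt by (simp add: optimal_solution_def)
  \<comment> \<open>The common optimal value is \<open>qubo_objective Q c x\<close>.\<close>
  with x have "\<exists>v. has_optimal_value (PK_feasible Q \<beta>) (milp_objective Q c) v
      \<and> has_optimal_value binary_vectors (qubo_objective Q c) v"
    unfolding has_optimal_value_def using milp_objective_product_extension by blast
  moreover have "optimal_solution binary_vectors (qubo_objective Q c) x"
    if xy: "optimal_solution (PK_feasible Q \<beta>) (milp_objective Q c) (x, y)" for x y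
  proof -
    \<comment> \<open>Membership in the graph identifies \<open>y\<close> with
      \<open>product_extension Q x\<close>, which brings the pair into the form that
      \<open>opt\<close> handles.\<close>
    have "(x, y) \<in> ?g ` binary_vectors"
      using xy by (simp add: optimal_solution_def F)
    then show ?thesis
      using xy opt by auto
  qed
  ultimately show ?thesis
    by (simp add: valid_formulation_def)
qed

end
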